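(* For a finite digraph $\langle\mathcal V,\to\rangle$ the following are equivalent: (1) $\langle\mathcal V,\to\rangle$ is strongly connected; (2) there is an incompressible dynamical system $\langle\mathbb A,\alpha\rangle$ and a partition $\mathcal A$ of $\mathbb A$ with $\langle\mathcal V,\to\rangle\cong\langle\mathcal A,\to_\alpha\rangle$; (3) there is a partition $\mathcal A$ of $\mathcal P(\omega)/\mathrm{Fin}$ with $\langle\mathcal V,\to\rangle\cong\langle\mathcal A,\to_\sigma\rangle$.
   Context: A digraph is a finite vertex set with an arbitrary binary relation (loops allowed); it is strongly connected if every vertex can be reached from every vertex by a walk. A dynamical system is a Boolean algebra $\mathbb A$ with an automorphism $\alpha$; it is incompressible if no $x\in\mathbb A\setminus\{\mathbf 0,\mathbf 1\}$ has $\alpha(x)\le x$. A partition of a Boolean algebra is a finite set of nonzero pairwise disjoint elements with join $\mathbf 1$; for a partition $\mathcal A$, $x\to_\alpha y$ iff $\alpha(x)\wedge y\ne\mathbf 0$. $\mathcal P(\omega)/\mathrm{Fin}$ is $\mathcal P(\omega)$ modulo finite sets and $\sigma([A])=[A+1]$ is the shift. *)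

theory Defs
  imports "HOL-Algebra.Lattice"
begin

section \<open>Digraphs\<close>

text \<open>The vertex set is required to be nonempty. For the empty digraph the equivalence fails: it is
  vacuously strongly connected, but the empty set is not a partition of a Boolean algebra with
  \<open>\<bottom> \<noteq> \<top>\<close>.\<close>

definition finite_digraph :: "'a set \<Rightarrow> ('a \<times> 'a) set \<Rightarrow> bool" where
  "finite_digraph V E \<longleftrightarrow> finite V \<and> V \<noteq> {} \<and> E \<subseteq> V \<times> V"

text \<open>A walk has at least one arrow, hence the transitive closure and not the reflexive-transitive
  one. The two versions of strong connectedness differ only for a single vertex without a loop, which
  does not count as strongly connected here: the one-element partition \<open>{\<top>}\<close> of a nontrivial Boolean
  algebra always carries a loop.\<close>

definition strongly_connected :: "'a set \<Rightarrow> ('a \<times> 'a) set \<Rightarrow> bool" where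
  "strongly_connected V E \<longleftrightarrow> (\<forall>v\<in>V. \<forall>w\<in>V. (v, w) \<in> E\<^sup>+)"

definition digraph_isomorphic ::
    "'a set \<Rightarrow> ('a \<times> 'a) set \<Rightarrow> 'b set \<Rightarrow> ('b \<times> 'b) set \<Rightarrow> bool" where
  "digraph_isomorphic V E W F \<longleftrightarrow>
     (\<exists>f. bij_betw f V W \<and> (\<forall>x\<in>V. \<forall>y\<in>V. (x, y) \<in> E \<longleftrightarrow> (f x, f y) \<in> F))"


section \<open>Boolean algebras, dynamical systems and partitions\<close>

text \<open>The type class \<^class>\<open>boolean_algebra\<close> does not permit quantification over Boolean
  algebras inside a formula, so Boolean algebras are complemented distributive lattices with an
  explicit carrier. The one-element algebra is not excluded.\<close>

locale boolean_lattice = bounded_lattice +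
  assumes meet_join_distrib:
      "\<lbrakk>x \<in> carrier L; y \<in> carrier L; z \<in> carrier L\<rbrakk>
        \<Longrightarrow> x \<sqinter> (y \<squnion> z) = (x \<sqinter> y) \<squnion> (x \<sqinter> z)"
    and complement_exists:
      "x \<in> carrier L \<Longrightarrow> \<exists>y\<in>carrier L. x \<squnion> y = \<top> \<and> x \<sqinter> y = \<bottom>"

definition complement :: "'b gorder \<Rightarrow> 'b \<Rightarrow> 'b" where
  "complement L x =
     (THE y. y \<in> carrier L \<and> x \<squnion>\<^bsub>L\<^esub> y = \<top>\<^bsub>L\<^esub> \<and> x \<sqinter>\<^bsub>L\<^esub> y = \<bottom>\<^bsub>L\<^esub>)"

definition boolean_automorphism :: "'b gorder \<Rightarrow> ('b \<Rightarrow> 'b) \<Rightarrow> bool" where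
  "boolean_automorphism L \<alpha> \<longleftrightarrow>
     bij_betw \<alpha> (carrier L) (carrier L) \<and>
     (\<forall>x\<in>carrier L. \<forall>y\<in>carrier L. \<alpha> (x \<squnion>\<^bsub>L\<^esub> y) = \<alpha> x \<squnion>\<^bsub>L\<^esub> \<alpha> y) \<and>
     (\<forall>x\<in>carrier L. \<forall>y\<in>carrier L. \<alpha> (x \<sqinter>\<^bsub>L\<^esub> y) = \<alpha> x \<sqinter>\<^bsub>L\<^esub> \<alpha> y) \<and>
     (\<forall>x\<in>carrier L. \<alpha> (complement L x) = complement L (\<alpha> x)) \<and>
     \<alpha> \<bottom>\<^bsub>L\<^esub> = \<bottom>\<^bsub>L\<^esub> \<and> \<alpha> \<top>\<^bsub>L\<^esub> = \<top>\<^bsub>L\<^esub>"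

definition dynamical_system :: "'b gorder \<Rightarrow> ('b \<Rightarrow> 'b) \<Rightarrow> bool" where
  "dynamical_system L \<alpha> \<longleftrightarrow> boolean_lattice L \<and> boolean_automorphism L \<alpha>"

definition incompressible :: "'b gorder \<Rightarrow> ('b \<Rightarrow> 'b) \<Rightarrow> bool" where
  "incompressible L \<alpha> \<longleftrightarrow> \<not> (\<exists>x\<in>carrier L - {\<bottom>\<^bsub>L\<^esub>, \<top>\<^bsub>L\<^esub>}. \<alpha> x \<sqsubseteq>\<^bsub>L\<^esub> x)"

definition boolean_partition :: "'b gorder \<Rightarrow> 'b set \<Rightarrow> bool" where
  "boolean_partition L P \<longleftrightarrow>
     finite P \<and> P \<subseteq> carrier L - {\<bottom>\<^bsub>L\<^esub>} \<and>
     pairwise (\<lambda>x y. x \<sqinter>\<^bsub>L\<^esub> y = \<bottom>\<^bsub>L\<^esub>) P \<and> \<Squnion>\<^bsub>L\<^esub>P = \<top>\<^bsub>L\<^esub>"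

definition partition_arrows :: "'b gorder \<Rightarrow> ('b \<Rightarrow> 'b) \<Rightarrow> 'b set \<Rightarrow> ('b \<times> 'b) set" where
  "partition_arrows L \<alpha> P = {(x, y) \<in> P \<times> P. \<alpha> x \<sqinter>\<^bsub>L\<^esub> y \<noteq> \<bottom>\<^bsub>L\<^esub>}"

definition represented_by_partition ::
    "'a set \<Rightarrow> ('a \<times> 'a) set \<Rightarrow> 'b gorder \<Rightarrow> ('b \<Rightarrow> 'b) \<Rightarrow> bool" where
  "represented_by_partition V E L \<alpha> \<longleftrightarrow>
     (\<exists>P. boolean_partition L P \<and> digraph_isomorphic V E P (partition_arrows L \<alpha> P))"


section \<open>The algebra of sets of naturals modulo finite sets and its shift\<close>

definition eq_mod_fin :: "(nat set \<times> nat set) set" where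
  "eq_mod_fin = {(A, B). finite ((A - B) \<union> (B - A))}"

definition Pow_mod_Fin :: "nat set set gorder" where
  "Pow_mod_Fin =
     \<lparr>carrier = UNIV // eq_mod_fin, eq = (=),
      le = (\<lambda>X Y. \<exists>A\<in>X. \<exists>B\<in>Y. finite (A - B))\<rparr>"

text \<open>The union is over all representatives of the class and amounts to choosing one, since
  \<open>A \<mapsto> A + 1\<close> respects \<^const>\<open>eq_mod_fin\<close>.\<close>

definition shift :: "nat set set \<Rightarrow> nat set set" where
  "shift X = (\<Union>A\<in>X. eq_mod_fin `` {Suc ` A})"

lemma equiv_eq_mod_fin: "equiv UNIV eq_mod_fin"
proof (rule equivI)
  show "trans eq_mod_fin"
  proof (rule transI)
    fix A B C assume "(A, B) \<in> eq_mod_fin" "(B, C) \<in> eq_mod_fin"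
    then have "finite (((A - B) \<union> (B - A)) \<union> ((B - C) \<union> (C - B)))"
      by (simp add: eq_mod_fin_def)
    then have "finite ((A - C) \<union> (C - A))"
      by (rule rev_finite_subset) auto
    then show "(A, C) \<in> eq_mod_fin"
      by (simp add: eq_mod_fin_def)
  qed
qed (auto simp: eq_mod_fin_def refl_on_def sym_def)

lemma shift_class: "shift (eq_mod_fin `` {A}) = eq_mod_fin `` {Suc ` A}"
  unfolding shift_def
proof (rule UN_equiv_class[OF equiv_eq_mod_fin])
  have "(\<lambda>A. eq_mod_fin `` {Suc ` A}) respects eq_mod_fin"
  proof (rule congruentI)
    fix A B assume "(A, B) \<in> eq_mod_fin"
    then have "(Suc ` A, Suc ` B) \<in> eq_mod_fin"
      by (simp add: eq_mod_fin_def image_set_diff[symmetric])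
    then show "eq_mod_fin `` {Suc ` A} = eq_mod_fin `` {Suc ` B}"
      by (rule equiv_class_eq[OF equiv_eq_mod_fin])
  qed
  then show "(\<lambda>A. eq_mod_fin `` {Suc ` A}) respects eq_mod_fin" .
qed simp

end

theory Submission
  imports Defs
begin

text \<open>If a partition of an incompressible system carries the digraph, the join of all cells
  reachable from a given cell is mapped below itself, so it is \<open>\<top>\<close> and every cell is reachable.
  Conversely, a strongly connected finite digraph has a closed walk using every arrow. Repeating it
  periodically gives an infinite walk \<open>w\<close>; the sets of times at which \<open>w\<close> visits the individual
  vertices partition \<open>\<omega>\<close> into infinite sets, and \<open>{n. w n = u} + 1\<close> meets \<open>{n. w n = v}\<close>
  in an infinite set exactly if \<open>(u, v)\<close> is an arrow. The shift is incompressible because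
  \<open>A + 1 \<subseteq> A\<close> modulo finite sets forces \<open>A\<close> to be finite or cofinite.\<close>

section \<open>Partitions of incompressible systems\<close>

text \<open>The inverse \<open>g\<close> of the vertex bijection carries arrows of \<open>F\<close>
  back to arrows of \<open>E\<close>, hence walks to walks;
  \<open>F \<subseteq> W \<times> W\<close> ensures that the endpoints are vertices
  \<open>f v\<close>.\<close>

lemma digraph_isomorphic_strongly_connected:
  assumes iso: "digraph_isomorphic V E W F" and E: "E \<subseteq> V \<times> V" and F: "F \<subseteq> W \<times> W"
    and sc: "strongly_connected W F"
  shows "strongly_connected V E"
proof -
  obtain f where f: "bij_betw f V W"
    and fE: "\<forall>x\<in>V. \<forall>y\<in>V. (x, y) \<in> E \<longleftrightarrow> (f x, f y) \<in> F"
    using iso by (auto simp: digraph_isomorphic_def)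
  define g where "g = the_inv_into V f"
  have gf: "g (f v) = v" if "v \<in> V" for v
    using f that by (simp add: g_def bij_betw_def the_inv_into_f_f)
  have step: "(g p, g q) \<in> E" if "(p, q) \<in> F" for p q
  proof -
    from that F f obtain v w where "v \<in> V" "w \<in> V" "p = f v" "q = f w"
      by (auto simp: bij_betw_def)
    with that fE gf show ?thesis by simp
  qed
  have lift: "(g p, g q) \<in> E\<^sup>+" if "(p, q) \<in> F\<^sup>+" for p q
    using that by (induction rule: trancl.induct) (auto intro: step trancl.trancl_into_trancl)
  show ?thesis
    unfolding strongly_connected_def
  proof (intro ballI)
    fix v w assume "v \<in> V" "w \<in> V"
    moreover from this f have "f v \<in> W" "f w \<in> W" by (auto simp: bij_betw_def)
    with sc have "(f v, f w) \<in> F\<^sup>+" by (auto simp: strongly_connected_def)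
    ultimately show "(v, w) \<in> E\<^sup>+" using lift gf by metis
  qed
qed

section \<open>Disjointness, complements and finite joins in a Boolean lattice\<close>

context boolean_lattice
begin

lemma bot_join: "x \<in> carrier L \<Longrightarrow> \<bottom> \<squnion> x = x"
  using bottom_join eq_is_equal by metis

lemma top_meet': "x \<in> carrier L \<Longrightarrow> \<top> \<sqinter> x = x"
  using top_meet eq_is_equal by metis

lemma le_bot_iff: "x \<in> carrier L \<Longrightarrow> x \<sqsubseteq> \<bottom> \<longleftrightarrow> x = \<bottom>"
  using bottom_lower bottom_closed le_antisym by blast

lemma meet_mono_bot:
  assumes "x \<in> carrier L" "x' \<in> carrier L" "y \<in> carrier L" "x' \<sqsubseteq> x" "x \<sqinter> y = \<bottom>"
  shows "x' \<sqinter> y = \<bottom>"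
proof -
  have "x' \<sqinter> y \<sqsubseteq> x \<sqinter> y"
    using assms by (meson le_trans meet_closed meet_le meet_left meet_right)
  with assms show ?thesis by (simp add: le_bot_iff)
qed

text \<open>Meeting \<open>p\<close> with \<open>x \<squnion> c = \<top>\<close> and distributing
  leaves \<open>p = p \<sqinter> c\<close>, because the part of \<open>p\<close> inside
  \<open>x\<close> vanishes.\<close>

lemma le_complement:
  assumes "x \<in> carrier L" "c \<in> carrier L" "p \<in> carrier L" "x \<squnion> c = \<top>" "p \<sqinter> x = \<bottom>"
  shows "p \<sqsubseteq> c"
proof -
  have "p = p \<sqinter> (x \<squnion> c)"
    using assms(3,4) top_meet'[of p] meet_comm[of L p \<top>] by simp
  also have "\<dots> = \<bottom> \<squnion> (p \<sqinter> c)"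
    using assms(1,2,3,5) by (simp add: meet_join_distrib)
  finally have "p = p \<sqinter> c"
    using assms by (simp add: bot_join)
  then show ?thesis using assms le_iff_join by blast
qed

text \<open>No induction on \<open>P\<close> is made: a complement of \<open>x\<close> is an upper
  bound of \<open>P\<close>, so it lies above the join.\<close>

lemma meet_sup_bot:
  assumes "finite P" "P \<subseteq> carrier L" "P \<noteq> {}" "x \<in> carrier L"
    and disj: "\<And>p. p \<in> P \<Longrightarrow> x \<sqinter> p = \<bottom>"
  shows "x \<sqinter> \<Squnion>P = \<bottom>"
proof -
  obtain c where c: "c \<in> carrier L" "x \<squnion> c = \<top>" "x \<sqinter> c = \<bottom>"
    using complement_exists assms(4) by blast
  have lub: "least L (\<Squnion>P) (Upper L P)" using assms by (simp add: finite_sup_least)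
  have "p \<sqsubseteq> c" if "p \<in> P" for p
    using that assms disj c le_complement[of x c p] meet_comm[of L p x] by auto
  then have "\<Squnion>P \<sqsubseteq> c"
    using c by (intro least_le[OF lub] Upper_memI) auto
  then have "\<Squnion>P \<sqinter> x = \<bottom>"
    using meet_mono_bot[of c "\<Squnion>P" x] c assms lub meet_comm[of L c x] by auto
  then show ?thesis by (simp add: meet_comm)
qed

end

text \<open>The cells join to \<open>\<top>\<close>, so \<open>x\<close> equals its meet with that
  join. Thus an element can be tested for being \<open>\<bottom>\<close> cell by cell.\<close>

lemma eq_bot_if_disjoint_partition:
  fixes L (structure)
  assumes L: "boolean_lattice L"
    and P: "boolean_partition L P" "P \<noteq> {}" and x: "x \<in> carrier L"
    and disj: "\<And>p. p \<in> P \<Longrightarrow> x \<sqinter> p = \<bottom>"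
  shows "x = \<bottom>"
proof -
  interpret boolean_lattice L by (rule L)
  have "x \<sqinter> \<Squnion>P = \<bottom>"
    using P x disj by (intro meet_sup_bot) (auto simp: boolean_partition_def)
  with P x show ?thesis
    by (simp add: boolean_partition_def meet_comm[of L x] top_meet')
qed

lemma strongly_connected_partition:
  fixes L (structure)
  assumes L: "boolean_lattice L"
    and aut: "boolean_automorphism L \<alpha>" and inc: "incompressible L \<alpha>"
    and part: "boolean_partition L P"
  shows "strongly_connected P (partition_arrows L \<alpha> P)"
  unfolding strongly_connected_def
proof (intro ballI)
  interpret boolean_lattice L by (rule L)
  fix v w assume v: "v \<in> P" and w: "w \<in> P"
  let ?F = "partition_arrows L \<alpha> P"
  define R where "R = {p. (v, p) \<in> ?F\<^sup>+}"
  define x where "x = \<Squnion>R"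
  have PL: "p \<in> carrier L" "p \<noteq> \<bottom>" if "p \<in> P" for p
    using part that by (auto simp: boolean_partition_def)
  have FP: "?F \<subseteq> P \<times> P" by (auto simp: partition_arrows_def)
  have RP: "R \<subseteq> P"
    using trancl_subset_Sigma[OF FP] by (auto simp: R_def)
  have finP: "finite P" using part by (simp add: boolean_partition_def)
  have Rfin: "finite R" "R \<subseteq> carrier L"
    using RP finP PL by (auto intro: finite_subset)
  have inj: "inj_on \<alpha> (carrier L)" and surj: "\<alpha> ` carrier L = carrier L"
    and ameet: "\<And>x y. x \<in> carrier L \<Longrightarrow> y \<in> carrier L \<Longrightarrow> \<alpha> (x \<sqinter> y) = \<alpha> x \<sqinter> \<alpha> y"
    and abot: "\<alpha> \<bottom> = \<bottom>"
    using aut by (auto simp: boolean_automorphism_def bij_betw_def)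
  have acl: "\<alpha> y \<in> carrier L" if "y \<in> carrier L" for y using surj that by blast
  have abot_iff: "\<alpha> y = \<bottom> \<longleftrightarrow> y = \<bottom>" if "y \<in> carrier L" for y
    using inj abot that bottom_closed by (metis inj_onD)
  \<comment> \<open>Were \<open>\<alpha> v\<close> disjoint from every cell, it would be
    \<open>\<bottom>\<close>, although \<open>\<alpha>\<close> is injective and
    \<open>v \<noteq> \<bottom>\<close>. The arrow found makes \<open>R\<close> nonempty, which is
    not automatic since \<open>R\<close> collects only cells reached by at least one arrow.\<close>
  have "\<exists>p\<in>P. \<alpha> v \<sqinter> p \<noteq> \<bottom>"
  proof (rule ccontr)
    assume "\<not> ?thesis"
    then have "\<alpha> v = \<bottom>"
      using v PL(1)[OF v] acl eq_bot_if_disjoint_partition[OF L part, of "\<alpha> v"] by auto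
    then show False using abot_iff PL v by blast
  qed
  then have "R \<noteq> {}" using v by (auto simp: R_def partition_arrows_def)
  then have lub: "least L x (Upper L R)"
    unfolding x_def using Rfin by (intro finite_sup_least)
  then have x: "x \<in> carrier L" by simp
  have le_x: "p \<sqsubseteq> x" if "p \<in> R" for p
    using least_Upper_above[OF lub] that Rfin by blast
  obtain c where c: "c \<in> carrier L" "x \<squnion> c = \<top>" "x \<sqinter> c = \<bottom>"
    using complement_exists[OF x] by blast
  \<comment> \<open>Pulling \<open>p\<close> back to \<open>p'\<close> turns the missing arrows
    \<open>(q, p)\<close> into disjointness of \<open>p'\<close> from each \<open>q \<in> R\<close>,
    hence from \<open>x\<close>. In this way only binary meets have to be moved through
    \<open>\<alpha>\<close>, never the join of \<open>R\<close>.\<close>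
  have image_disjoint: "\<alpha> x \<sqinter> p = \<bottom>" if p: "p \<in> P" "p \<notin> R" for p
  proof -
    have "p \<in> \<alpha> ` carrier L" using PL(1)[OF p(1)] by (simp add: surj)
    then obtain p' where p': "p' \<in> carrier L" "p = \<alpha> p'" by blast
    have "p' \<sqinter> q = \<bottom>" if q: "q \<in> R" for q
    proof -
      have "(q, p) \<notin> ?F"
        using q p by (auto simp: R_def intro: trancl.trancl_into_trancl)
      then have "\<alpha> q \<sqinter> p = \<bottom>" using q p RP by (auto simp: partition_arrows_def)
      then have "\<alpha> (q \<sqinter> p') = \<bottom>" using ameet p' q Rfin by auto
      then show ?thesis using abot_iff p' q Rfin meet_comm[of L p' q] by auto
    qed
    then have "p' \<sqinter> x = \<bottom>"
      unfolding x_def using Rfin \<open>R \<noteq> {}\<close> p' by (intro meet_sup_bot)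
    then have "\<alpha> (x \<sqinter> p') = \<bottom>" using abot by (simp add: meet_comm)
    then show ?thesis using ameet x p' by simp
  qed
  \<comment> \<open>This expresses \<open>\<alpha> x \<sqsubseteq> x\<close> through the complement
    \<open>c\<close> of \<open>x\<close>. Cells in \<open>R\<close> lie below \<open>x\<close> and
    miss \<open>c\<close>; all other cells miss \<open>\<alpha> x\<close>.\<close>
  have "\<alpha> x \<sqinter> c = \<bottom>"
  proof (rule eq_bot_if_disjoint_partition[OF L part])
    fix p assume p: "p \<in> P"
    let ?z = "\<alpha> x \<sqinter> c"
    have z: "?z \<in> carrier L" "?z \<sqsubseteq> \<alpha> x" "?z \<sqsubseteq> c"
      using x c acl by (auto intro: meet_left meet_right)
    show "?z \<sqinter> p = \<bottom>"
    proof (cases "p \<in> R")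
      case True
      then have "p \<sqinter> c = \<bottom>" using meet_mono_bot[of x p c] le_x c x p PL by blast
      then show ?thesis using meet_mono_bot[of c ?z p] z c p PL meet_comm[of L p c] by auto
    next
      case False
      then show ?thesis
        using meet_mono_bot[of "\<alpha> x" ?z p] image_disjoint z p PL x acl by auto
    qed
  qed (use v x c acl in auto)
  then have "\<alpha> x \<sqsubseteq> x"
    using le_complement[of c x "\<alpha> x"] c x acl join_comm[of L c x] by auto
  moreover have "x \<noteq> \<bottom>"
    using \<open>R \<noteq> {}\<close> le_x RP PL le_bot_iff by blast
  ultimately have "x = \<top>" using inc x by (auto simp: incompressible_def)
  \<comment> \<open>A cell outside \<open>R\<close> is disjoint from all cells in \<open>R\<close>,
    hence from their join \<open>x = \<top>\<close>, which is impossible for a nonzero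
    element.\<close>
  show "(v, w) \<in> ?F\<^sup>+"
  proof (rule ccontr)
    assume "(v, w) \<notin> ?F\<^sup>+"
    then have "w \<notin> R" by (simp add: R_def)
    have disj: "pairwise (\<lambda>x y. x \<sqinter> y = \<bottom>) P"
      using part by (simp add: boolean_partition_def)
    have "w \<sqinter> p = \<bottom>" if "p \<in> R" for p
      using that RP \<open>w \<notin> R\<close> by (intro pairwiseD[OF disj] w) auto
    then have "w \<sqinter> x = \<bottom>"
      unfolding x_def using Rfin \<open>R \<noteq> {}\<close> PL w by (intro meet_sup_bot) auto
    then show False
      using \<open>x = \<top>\<close> PL[OF w] by (simp add: meet_comm[of L w] top_meet')
  qed
qed

lemma strongly_connected_if_represented:
  assumes "finite_digraph V E" "dynamical_system L \<alpha>" "incompressible L \<alpha>"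
    "represented_by_partition V E L \<alpha>"
  shows "strongly_connected V E"
proof -
  obtain P where P: "boolean_partition L P" "digraph_isomorphic V E P (partition_arrows L \<alpha> P)"
    using assms by (auto simp: represented_by_partition_def)
  show ?thesis
  proof (rule digraph_isomorphic_strongly_connected[OF P(2)])
    show "strongly_connected P (partition_arrows L \<alpha> P)"
      using assms P by (intro strongly_connected_partition)
        (auto simp: dynamical_system_def)
  qed (use assms in \<open>auto simp: finite_digraph_def partition_arrows_def\<close>)
qed

section \<open>The shift on sets of naturals modulo finite sets\<close>

abbreviation mod_fin :: "nat set \<Rightarrow> nat set set" where
  "mod_fin A \<equiv> eq_mod_fin `` {A}"

lemma mod_fin_eq_iff: "mod_fin A = mod_fin B \<longleftrightarrow> finite (A - B) \<and> finite (B - A)"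
  using eq_equiv_class_iff[OF equiv_eq_mod_fin, of A B] by (simp add: eq_mod_fin_def)

lemma carrier_Pow_mod_Fin: "carrier Pow_mod_Fin = range mod_fin"
  by (auto simp: Pow_mod_Fin_def quotient_def)

lemma mod_fin_in_carrier [simp]: "mod_fin A \<in> carrier Pow_mod_Fin"
  by (simp add: carrier_Pow_mod_Fin)

lemma ball_carrier_Pow_mod_Fin:
  "(\<forall>x\<in>carrier Pow_mod_Fin. Q x) \<longleftrightarrow> (\<forall>A. Q (mod_fin A))"
  by (simp add: carrier_Pow_mod_Fin)

text \<open>The order asks for some pair of representatives \<open>A'\<close>, \<open>B'\<close>;
  the given pair then works too, because \<open>A - B\<close> lies in
  \<open>(A - A') \<union> (A' - B') \<union> (B' - B)\<close>.\<close>

lemma mod_fin_le_iff: "mod_fin A \<sqsubseteq>\<^bsub>Pow_mod_Fin\<^esub> mod_fin B \<longleftrightarrow> finite (A - B)"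
proof
  assume "mod_fin A \<sqsubseteq>\<^bsub>Pow_mod_Fin\<^esub> mod_fin B"
  then obtain A' B' where "finite ((A - A') \<union> (A' - A))" "finite ((B - B') \<union> (B' - B))"
    "finite (A' - B')"
    by (auto simp: Pow_mod_Fin_def eq_mod_fin_def)
  then have "finite ((A - A') \<union> (A' - B') \<union> (B' - B))" by simp
  then show "finite (A - B)" by (rule rev_finite_subset) auto
next
  assume "finite (A - B)"
  moreover have "A \<in> mod_fin A" "B \<in> mod_fin B" by (auto simp: eq_mod_fin_def)
  ultimately show "mod_fin A \<sqsubseteq>\<^bsub>Pow_mod_Fin\<^esub> mod_fin B"
    by (auto simp: Pow_mod_Fin_def)
qed

lemma partial_order_Pow_mod_Fin: "partial_order Pow_mod_Fin"
proof unfold_locales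
  fix x y z
  assume xyz: "x \<sqsubseteq>\<^bsub>Pow_mod_Fin\<^esub> y" "y \<sqsubseteq>\<^bsub>Pow_mod_Fin\<^esub> z"
    "x \<in> carrier Pow_mod_Fin" "y \<in> carrier Pow_mod_Fin" "z \<in> carrier Pow_mod_Fin"
  then obtain A B C where ABC: "x = mod_fin A" "y = mod_fin B" "z = mod_fin C"
    by (auto simp: carrier_Pow_mod_Fin)
  with xyz have "finite ((A - B) \<union> (B - C))" by (simp add: mod_fin_le_iff)
  then have "finite (A - C)" by (rule rev_finite_subset) auto
  with ABC show "x \<sqsubseteq>\<^bsub>Pow_mod_Fin\<^esub> z" by (simp add: mod_fin_le_iff)
next
  fix x y
  assume "x \<sqsubseteq>\<^bsub>Pow_mod_Fin\<^esub> y" "y \<sqsubseteq>\<^bsub>Pow_mod_Fin\<^esub> x"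
    "x \<in> carrier Pow_mod_Fin" "y \<in> carrier Pow_mod_Fin"
  then show "x .=\<^bsub>Pow_mod_Fin\<^esub> y"
    by (auto simp: carrier_Pow_mod_Fin mod_fin_le_iff mod_fin_eq_iff)
       (auto simp: Pow_mod_Fin_def mod_fin_eq_iff)
next
  fix x assume "x \<in> carrier Pow_mod_Fin"
  then show "x \<sqsubseteq>\<^bsub>Pow_mod_Fin\<^esub> x"
    by (auto simp: carrier_Pow_mod_Fin mod_fin_le_iff)
qed (auto simp: Pow_mod_Fin_def)

interpretation PF: partial_order Pow_mod_Fin
  by (rule partial_order_Pow_mod_Fin)

text \<open>\<open>(A \<union> B) - C\<close> is the union of \<open>A - C\<close> and
  \<open>B - C\<close>. The explicit bound serves twice: it shows that joins exist and, by
  uniqueness, what they are.\<close>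

lemma least_Upper_mod_fin:
  "least Pow_mod_Fin (mod_fin (A \<union> B)) (Upper Pow_mod_Fin {mod_fin A, mod_fin B})"
proof (rule least_UpperI)
  fix y assume y: "y \<in> Upper Pow_mod_Fin {mod_fin A, mod_fin B}"
  moreover from y obtain C where C: "y = mod_fin C"
    by (auto simp: Upper_def carrier_Pow_mod_Fin)
  ultimately have "finite ((A - C) \<union> (B - C))" by (auto simp: Upper_def mod_fin_le_iff)
  then show "mod_fin (A \<union> B) \<sqsubseteq>\<^bsub>Pow_mod_Fin\<^esub> y"
    unfolding C mod_fin_le_iff by (rule rev_finite_subset) auto
qed (auto simp: mod_fin_le_iff Diff_eq)

lemma greatest_Lower_mod_fin:
  "greatest Pow_mod_Fin (mod_fin (A \<inter> B)) (Lower Pow_mod_Fin {mod_fin A, mod_fin B})"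
proof (rule greatest_LowerI)
  fix y assume y: "y \<in> Lower Pow_mod_Fin {mod_fin A, mod_fin B}"
  moreover from y obtain C where C: "y = mod_fin C"
    by (auto simp: Lower_def carrier_Pow_mod_Fin)
  ultimately have "finite ((C - A) \<union> (C - B))" by (auto simp: Lower_def mod_fin_le_iff)
  then show "y \<sqsubseteq>\<^bsub>Pow_mod_Fin\<^esub> mod_fin (A \<inter> B)"
    unfolding C mod_fin_le_iff by (rule rev_finite_subset) auto
qed (auto simp: mod_fin_le_iff Diff_eq)

interpretation PF: bounded_lattice Pow_mod_Fin
proof unfold_locales
  show "\<exists>x. least Pow_mod_Fin x (carrier Pow_mod_Fin)"
    by (rule exI[of _ "mod_fin {}"]) (auto simp: least_def carrier_Pow_mod_Fin mod_fin_le_iff)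
  show "\<exists>x. greatest Pow_mod_Fin x (carrier Pow_mod_Fin)"
    by (rule exI[of _ "mod_fin UNIV"])
      (auto simp: greatest_def carrier_Pow_mod_Fin mod_fin_le_iff)
qed (auto simp: carrier_Pow_mod_Fin intro: least_Upper_mod_fin greatest_Lower_mod_fin)

lemma bottom_Pow_mod_Fin: "\<bottom>\<^bsub>Pow_mod_Fin\<^esub> = mod_fin {}"
  by (rule PF.bottom_eq[symmetric]) (auto simp: carrier_Pow_mod_Fin mod_fin_le_iff)

lemma top_Pow_mod_Fin: "\<top>\<^bsub>Pow_mod_Fin\<^esub> = mod_fin UNIV"
  by (rule PF.top_eq[symmetric]) (auto simp: carrier_Pow_mod_Fin mod_fin_le_iff)

text \<open>The join is a chosen least upper bound. Taking equality with the expected class as the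
  predicate in \<open>joinI\<close> leaves only the uniqueness of least elements.\<close>

lemma join_mod_fin: "mod_fin A \<squnion>\<^bsub>Pow_mod_Fin\<^esub> mod_fin B = mod_fin (A \<union> B)"
  by (rule PF.joinI[of _ _ "\<lambda>s. s = mod_fin (A \<union> B)"])
    (simp_all add: PF.least_unique[OF _ least_Upper_mod_fin])

lemma meet_mod_fin: "mod_fin A \<sqinter>\<^bsub>Pow_mod_Fin\<^esub> mod_fin B = mod_fin (A \<inter> B)"
  by (rule PF.meetI[of _ _ "\<lambda>s. s = mod_fin (A \<inter> B)"])
    (simp_all add: PF.greatest_unique[OF _ greatest_Lower_mod_fin])

interpretation PF: boolean_lattice Pow_mod_Fin
proof unfold_locales
  fix x assume "x \<in> carrier Pow_mod_Fin"
  then obtain A where "x = mod_fin A" by (auto simp: carrier_Pow_mod_Fin)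
  then show "\<exists>y\<in>carrier Pow_mod_Fin.
      x \<squnion>\<^bsub>Pow_mod_Fin\<^esub> y = \<top>\<^bsub>Pow_mod_Fin\<^esub> \<and> x \<sqinter>\<^bsub>Pow_mod_Fin\<^esub> y = \<bottom>\<^bsub>Pow_mod_Fin\<^esub>"
    by (intro bexI[of _ "mod_fin (- A)"])
      (auto simp: join_mod_fin meet_mod_fin bottom_Pow_mod_Fin top_Pow_mod_Fin)
qed (auto simp: carrier_Pow_mod_Fin join_mod_fin meet_mod_fin Int_Un_distrib)

lemma complement_mod_fin: "complement Pow_mod_Fin (mod_fin A) = mod_fin (- A)"
  unfolding complement_def
proof (rule the_equality)
  fix y
  assume y: "y \<in> carrier Pow_mod_Fin \<and> mod_fin A \<squnion>\<^bsub>Pow_mod_Fin\<^esub> y = \<top>\<^bsub>Pow_mod_Fin\<^esub> \<and>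
    mod_fin A \<sqinter>\<^bsub>Pow_mod_Fin\<^esub> y = \<bottom>\<^bsub>Pow_mod_Fin\<^esub>"
  then obtain B where "y = mod_fin B" by (auto simp: carrier_Pow_mod_Fin)
  \<comment> \<open>The join being \<open>\<top>\<close> makes \<open>- A - B\<close> finite, and
    the meet being \<open>\<bottom>\<close> makes \<open>A \<inter> B\<close>, which is
    \<open>B - (- A)\<close>, finite.\<close>
  with y show "y = mod_fin (- A)"
    by (auto simp: join_mod_fin meet_mod_fin bottom_Pow_mod_Fin top_Pow_mod_Fin mod_fin_eq_iff
        Diff_eq Int_commute)
qed (auto simp: join_mod_fin meet_mod_fin bottom_Pow_mod_Fin top_Pow_mod_Fin)

section \<open>The shift as an incompressible automorphism\<close>

lemma shift_mod_fin_eq_iff: "mod_fin (Suc ` A) = mod_fin (Suc ` B) \<longleftrightarrow> mod_fin A = mod_fin B"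
  by (simp add: mod_fin_eq_iff image_set_diff[symmetric] finite_image_iff)

text \<open>Moving \<open>A\<close> down by one and up again loses at most the point
  \<open>0\<close>, which the quotient ignores. This makes the shift surjective and lets it fix
  \<open>\<top>\<close>.\<close>

lemma mod_fin_predecessors: "mod_fin (Suc ` {n. Suc n \<in> A}) = mod_fin A"
proof -
  have "A - Suc ` {n. Suc n \<in> A} \<subseteq> {0}"
  proof
    fix n assume "n \<in> A - Suc ` {n. Suc n \<in> A}"
    then show "n \<in> {0}" by (cases n) auto
  qed
  then have "finite (A - Suc ` {n. Suc n \<in> A})" by (rule finite_subset) simp
  moreover have "finite (Suc ` {n. Suc n \<in> A} - A)"
    by (rule finite_subset[of _ "{}"]) auto
  ultimately show ?thesis by (simp only: mod_fin_eq_iff simp_thms)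
qed

lemma boolean_automorphism_shift: "boolean_automorphism Pow_mod_Fin shift"
  unfolding boolean_automorphism_def ball_carrier_Pow_mod_Fin
proof (intro conjI allI)
  have "inj_on shift (carrier Pow_mod_Fin)"
    by (auto simp: inj_on_def carrier_Pow_mod_Fin shift_class shift_mod_fin_eq_iff)
  moreover have "shift ` carrier Pow_mod_Fin = carrier Pow_mod_Fin"
  proof
    show "shift ` carrier Pow_mod_Fin \<subseteq> carrier Pow_mod_Fin"
      by (auto simp: carrier_Pow_mod_Fin shift_class)
    show "carrier Pow_mod_Fin \<subseteq> shift ` carrier Pow_mod_Fin"
    proof
      fix x assume "x \<in> carrier Pow_mod_Fin"
      then obtain A where "x = mod_fin A" by (auto simp: carrier_Pow_mod_Fin)
      then have "x = shift (mod_fin {n. Suc n \<in> A})"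
        by (simp add: shift_class mod_fin_predecessors)
      then show "x \<in> shift ` carrier Pow_mod_Fin" by simp
    qed
  qed
  ultimately show "bij_betw shift (carrier Pow_mod_Fin) (carrier Pow_mod_Fin)"
    by (simp add: bij_betw_def)
next
  have UNIV: "mod_fin (Suc ` UNIV) = mod_fin UNIV"
    using mod_fin_predecessors[of UNIV] by simp
  then show "shift \<top>\<^bsub>Pow_mod_Fin\<^esub> = \<top>\<^bsub>Pow_mod_Fin\<^esub>"
    by (simp add: top_Pow_mod_Fin shift_class)
  fix A
  \<comment> \<open>The image of the complement and the complement of the image differ in
    \<open>0\<close> alone, the only number that is not a successor.\<close>
  have "finite (Suc ` (- A) - - Suc ` A)"
    by (rule finite_subset[of _ "{}"]) auto
  moreover have "- Suc ` A - Suc ` (- A) \<subseteq> {0}"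
  proof
    fix n assume "n \<in> - Suc ` A - Suc ` (- A)"
    then show "n \<in> {0}" by (cases n) auto
  qed
  then have "finite (- Suc ` A - Suc ` (- A))" by (rule finite_subset) simp
  ultimately have "mod_fin (Suc ` (- A)) = mod_fin (- Suc ` A)"
    by (simp only: mod_fin_eq_iff simp_thms)
  then show "shift (complement Pow_mod_Fin (mod_fin A)) =
      complement Pow_mod_Fin (shift (mod_fin A))"
    by (simp add: complement_mod_fin shift_class)
qed (simp_all add: join_mod_fin meet_mod_fin bottom_Pow_mod_Fin shift_class image_Un image_Int)

lemma dynamical_system_shift: "dynamical_system Pow_mod_Fin shift"
  by (simp add: dynamical_system_def boolean_automorphism_shift PF.boolean_lattice_axioms)

lemma incompressible_shift: "incompressible Pow_mod_Fin shift"
  unfolding incompressible_def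
proof
  assume "\<exists>x\<in>carrier Pow_mod_Fin - {\<bottom>\<^bsub>Pow_mod_Fin\<^esub>, \<top>\<^bsub>Pow_mod_Fin\<^esub>}. shift x \<sqsubseteq>\<^bsub>Pow_mod_Fin\<^esub> x"
  then obtain A where "mod_fin A \<noteq> mod_fin {}" "mod_fin A \<noteq> mod_fin UNIV"
    "shift (mod_fin A) \<sqsubseteq>\<^bsub>Pow_mod_Fin\<^esub> mod_fin A"
    unfolding carrier_Pow_mod_Fin bottom_Pow_mod_Fin top_Pow_mod_Fin by blast
  then have A: "infinite A" "infinite (- A)" and fin: "finite (Suc ` A - A)"
    by (simp_all add: mod_fin_eq_iff shift_class mod_fin_le_iff Compl_eq_Diff_UNIV)
  \<comment> \<open>All points of \<open>A + 1\<close> outside \<open>A\<close> are below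
    \<open>N\<close>. From an element \<open>m \<ge> N\<close> of \<open>A\<close> on, membership
    therefore passes from \<open>n\<close> to \<open>Suc n\<close> without end, and \<open>A\<close>
    is cofinite.\<close>
  obtain N where N: "\<forall>n\<in>Suc ` A - A. n < N"
    using fin unfolding finite_nat_set_iff_bounded by (rule exE)
  obtain m where m: "m \<in> A" "m \<ge> N"
    using A(1) unfolding finite_nat_set_iff_bounded by (auto simp: not_less)
  have "n \<in> A" if "m \<le> n" for n
    using that
  proof (induction n rule: dec_induct)
    case base
    show ?case by (rule m)
  next
    case (step n)
    then have "Suc n \<in> Suc ` A" "\<not> Suc n < N" using m by auto
    then show ?case using N by blast
  qed
  then have "- A \<subseteq> {..<m}" by (auto simp: not_le[symmetric])
  then show False using A(2) finite_subset by blast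
qed

section \<open>Closed walks through all arrows\<close>

text \<open>\<open>n\<close> counts arrows: the walk runs from \<open>w 0\<close> to
  \<open>w n\<close>, and the later values of \<open>w\<close> are arbitrary.\<close>

definition walk :: "('a \<times> 'a) set \<Rightarrow> (nat \<Rightarrow> 'a) \<Rightarrow> nat \<Rightarrow> bool" where
  "walk E w n \<longleftrightarrow> (\<forall>i<n. (w i, w (Suc i)) \<in> E)"

lemma trancl_walk:
  assumes "(x, y) \<in> E\<^sup>+"
  shows "\<exists>w n. walk E w n \<and> w 0 = x \<and> w n = y"
proof -
  obtain n where "(x, y) \<in> E ^^ n" using assms trancl_power by blast
  then obtain w where "w 0 = x" "w n = y" "\<forall>i<n. (w i, w (Suc i)) \<in> E"
    using relpow_fun_conv by metis
  then show ?thesis unfolding walk_def by blast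
qed

text \<open>The two pieces fit because \<open>w n = w' 0\<close>. The last two conjuncts record
  where the arrows of either walk reappear, so that arrows already covered can be found
  again.\<close>

lemma walk_append:
  assumes "walk E w n" "walk E w' n'" "w n = w' 0"
  shows "\<exists>u. walk E u (n + n') \<and> u 0 = w 0 \<and> u (n + n') = w' n' \<and>
    (\<forall>i<n. u i = w i \<and> u (Suc i) = w (Suc i)) \<and>
    (\<forall>i<n'. u (n + i) = w' i \<and> u (Suc (n + i)) = w' (Suc i))"
proof -
  let ?u = "\<lambda>i. if i \<le> n then w i else w' (i - n)"
  have *: "?u (n + i) = w' i" for i using assms(3) by auto
  have "(?u i, ?u (Suc i)) \<in> E" if "i < n + n'" for i
  proof (cases "i < n")
    case True
    then show ?thesis using assms(1) by (simp add: walk_def)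
  next
    case False
    then obtain j where "i = n + j" using le_Suc_ex not_less by blast
    with that show ?thesis
      using assms(2,3) *[of j] *[of "Suc j"] by (auto simp: walk_def)
  qed
  moreover have "?u (n + n') = w' n'" by (rule *)
  moreover have "\<forall>i<n'. ?u (n + i) = w' i \<and> ?u (Suc (n + i)) = w' (Suc i)"
    using * *[of "Suc _"] by simp
  ultimately show ?thesis
    unfolding walk_def by (intro exI[of _ ?u]) auto
qed

text \<open>By induction on \<open>F\<close>, the closed walk is prolonged by a detour from
  \<open>v\<close> to the tail of the new arrow, along that arrow, and from its head back to
  \<open>v\<close>. Strong connectedness provides both connecting walks.\<close>

lemma closed_walk_covering:
  assumes sc: "strongly_connected V E" and E: "E \<subseteq> V \<times> V" and v: "v \<in> V"
    and F: "finite F" "F \<subseteq> E"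
  shows "\<exists>w n. walk E w n \<and> w 0 = v \<and> w n = v \<and> (\<forall>e\<in>F. \<exists>i<n. e = (w i, w (Suc i)))"
  using F
proof (induction F rule: finite_induct)
  case empty
  show ?case by (rule exI[of _ "\<lambda>_. v"], rule exI[of _ 0]) (simp add: walk_def)
next
  case (insert e F)
  then obtain w n where w: "walk E w n" "w 0 = v" "w n = v"
    and cov: "\<forall>e\<in>F. \<exists>i<n. e = (w i, w (Suc i))"
    by auto
  obtain a b where e: "e = (a, b)" by (cases e)
  with insert.prems E have ab: "(a, b) \<in> E" "a \<in> V" "b \<in> V" by auto
  obtain w1 n1 where w1: "walk E w1 n1" "w1 0 = v" "w1 n1 = a"
    using trancl_walk sc v ab unfolding strongly_connected_def by metis
  obtain w2 n2 where w2: "walk E w2 n2" "w2 0 = b" "w2 n2 = v"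
    using trancl_walk sc v ab unfolding strongly_connected_def by metis
  define s where "s = (\<lambda>i::nat. if i = 0 then a else b)"
  have s: "walk E s 1" "s 0 = a" "s 1 = b" using ab by (auto simp: s_def walk_def)
  obtain u1 where u1: "walk E u1 (1 + n2)" "u1 0 = a" "u1 (1 + n2) = v" "u1 (Suc 0) = b"
    using walk_append[OF s(1) w2(1)] s w2 by force
  obtain u2 where u2: "walk E u2 (n1 + (1 + n2))" "u2 0 = v" "u2 (n1 + (1 + n2)) = v"
    "u2 n1 = a" "u2 (Suc n1) = b"
    using walk_append[OF w1(1) u1(1)] w1 u1
    by (metis add.right_neutral add_gr_0 zero_less_one)
  obtain u where u: "walk E u (n + (n1 + (1 + n2)))" "u 0 = v" "u (n + (n1 + (1 + n2))) = v"
    and uw: "\<forall>i<n. u i = w i \<and> u (Suc i) = w (Suc i)"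
    and uu: "\<forall>i<n1 + (1 + n2). u (n + i) = u2 i \<and> u (Suc (n + i)) = u2 (Suc i)"
    using walk_append[OF w(1) u2(1)] w u2 by metis
  let ?n = "n + (n1 + (1 + n2))"
  \<comment> \<open>The old closed walk takes \<open>n\<close> arrows and the way from
    \<open>v\<close> to \<open>a\<close> another \<open>n1\<close>, so \<open>e\<close> is used at
    time \<open>n + n1\<close>.\<close>
  have "\<exists>i<?n. e = (u i, u (Suc i))"
    using uu u2 e by (intro exI[of _ "n + n1"]) auto
  moreover have "\<exists>i<?n. e' = (u i, u (Suc i))" if e': "e' \<in> F" for e'
  proof -
    obtain i where "i < n" "e' = (w i, w (Suc i))" using cov e' by blast
    with uw show ?thesis by (intro exI[of _ i]) simp
  qed
  ultimately show ?case
    using u by (intro exI[of _ u] exI[of _ ?n]) simp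
qed

lemma infinite_walk:
  assumes G: "finite_digraph V E" and sc: "strongly_connected V E"
  shows "\<exists>w. (\<forall>i. (w i, w (Suc i)) \<in> E) \<and> (\<forall>e\<in>E. infinite {i. (w i, w (Suc i)) = e})"
proof -
  obtain v where v: "v \<in> V" using G by (auto simp: finite_digraph_def)
  have E: "E \<subseteq> V \<times> V" "finite E" "E \<noteq> {}"
    using G sc v finite_subset[of E "V \<times> V"]
    by (auto simp: finite_digraph_def strongly_connected_def)
  obtain c n where c: "walk E c n" "c 0 = v" "c n = v"
    and cov: "\<forall>e\<in>E. \<exists>i<n. e = (c i, c (Suc i))"
    using closed_walk_covering[OF sc E(1) v E(2)] by blast
  have n: "n > 0" using cov E(3) by fastforce
  define w where "w i = c (i mod n)" for i
  \<comment> \<open>At the end of a period \<open>w (Suc i)\<close> is \<open>c 0\<close>, which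
    equals \<open>c n\<close> since the walk is closed; so reduction modulo \<open>n\<close> breaks
    no arrow.\<close>
  have w: "(w i, w (Suc i)) = (c (i mod n), c (Suc (i mod n)))" for i
    using c by (auto simp: w_def mod_Suc)
  show ?thesis
  proof (intro exI[of _ w] conjI allI ballI)
    show "(w i, w (Suc i)) \<in> E" for i
      unfolding w using c(1) n by (simp add: walk_def)
    fix e assume "e \<in> E"
    then obtain i where i: "i < n" "e = (c i, c (Suc i))" using cov by blast
    have "range (\<lambda>k. i + k * n) \<subseteq> {j. (w j, w (Suc j)) = e}"
      unfolding w using i by auto
    moreover have "inj (\<lambda>k. i + k * n)" using n by (auto simp: inj_def)
    ultimately show "infinite {j. (w j, w (Suc j)) = e}"
      using infinite_super finite_imageD infinite_UNIV_nat by metis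
  qed
qed

section \<open>The partition read off an infinite walk\<close>

lemma represented_if_strongly_connected:
  fixes V :: "'a set"
  assumes G: "finite_digraph V E" and sc: "strongly_connected V E"
  shows "represented_by_partition V E Pow_mod_Fin shift"
proof -
  obtain w :: "nat \<Rightarrow> 'a" where w: "\<forall>i. (w i, w (Suc i)) \<in> E"
    "\<forall>e\<in>E. infinite {i. (w i, w (Suc i)) = e}"
    using infinite_walk[OF assms] by (elim exE conjE)
  have wE: "(w i, w (Suc i)) \<in> E" for i using w(1) by (rule spec)
  have inf: "infinite {i. (w i, w (Suc i)) = e}" if "e \<in> E" for e using w(2) that by (rule bspec)
  define A where "A v = {i. w i = v}" for v
  define f where "f v = mod_fin (A v)" for v
  have V: "finite V" "V \<noteq> {}" "E \<subseteq> V \<times> V" using G by (auto simp: finite_digraph_def)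
  have wV: "w i \<in> V" for i using wE V by blast
  \<comment> \<open>Some arrow leaves \<open>v\<close>, since \<open>(v, v) \<in> E\<^sup>+\<close>,
    and the walk uses this arrow infinitely often.\<close>
  have infA: "infinite (A v)" if v: "v \<in> V" for v
  proof -
    have "(v, v) \<in> E\<^sup>+" using sc v by (simp add: strongly_connected_def)
    then obtain u where "(v, u) \<in> E" by (meson tranclD)
    from inf[OF this] show ?thesis
      by (rule infinite_super[rotated]) (auto simp: A_def)
  qed
  have disj: "A u \<inter> A v = {}" if "u \<noteq> v" for u v using that by (auto simp: A_def)
  have injf: "inj_on f V"
  proof (rule inj_onI, rule ccontr)
    fix u v assume "u \<in> V" "v \<in> V" "f u = f v" "u \<noteq> v"
    moreover from this disj have "A u - A v = A u" by blast
    ultimately show False using infA by (simp add: f_def mod_fin_eq_iff)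
  qed
  have fne: "f v \<noteq> \<bottom>\<^bsub>Pow_mod_Fin\<^esub>" if "v \<in> V" for v
    using infA that by (simp add: f_def bottom_Pow_mod_Fin mod_fin_eq_iff)
  \<comment> \<open>The meet is the class of the times just after a use of \<open>(u, v)\<close>.
    Their set is empty for a non-arrow and infinite for an arrow, so nothing is lost modulo finite
    sets.\<close>
  have arrow: "shift (f u) \<sqinter>\<^bsub>Pow_mod_Fin\<^esub> f v \<noteq> \<bottom>\<^bsub>Pow_mod_Fin\<^esub> \<longleftrightarrow> (u, v) \<in> E" for u v
  proof -
    have *: "Suc ` A u \<inter> A v = Suc ` {i. (w i, w (Suc i)) = (u, v)}"
      by (auto simp: A_def)
    have "shift (f u) \<sqinter>\<^bsub>Pow_mod_Fin\<^esub> f v \<noteq> \<bottom>\<^bsub>Pow_mod_Fin\<^esub>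
        \<longleftrightarrow> infinite {i. (w i, w (Suc i)) = (u, v)}"
      by (simp add: f_def shift_class meet_mod_fin bottom_Pow_mod_Fin mod_fin_eq_iff *
          finite_image_iff del: prod.inject)
    also have "\<dots> \<longleftrightarrow> (u, v) \<in> E"
    proof
      assume "infinite {i. (w i, w (Suc i)) = (u, v)}"
      then obtain i where "(w i, w (Suc i)) = (u, v)"
        using not_finite_existsD by blast
      then show "(u, v) \<in> E" using wE[of i] by simp
    qed (rule inf)
    finally show ?thesis .
  qed
  have lub: "least Pow_mod_Fin (\<Squnion>\<^bsub>Pow_mod_Fin\<^esub>(f ` V)) (Upper Pow_mod_Fin (f ` V))"
    using V by (intro PF.finite_sup_least) (auto simp: f_def)
  \<comment> \<open>The supremum is the class of some \<open>C\<close> containing each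
    \<open>A v\<close> up to finitely many points. As \<open>V\<close> is finite and the sets
    \<open>A v\<close> cover all times, \<open>C\<close> is cofinite.\<close>
  have sup: "\<Squnion>\<^bsub>Pow_mod_Fin\<^esub>(f ` V) = \<top>\<^bsub>Pow_mod_Fin\<^esub>"
  proof -
    obtain C where C: "\<Squnion>\<^bsub>Pow_mod_Fin\<^esub>(f ` V) = mod_fin C"
      using least_closed[OF lub] by (auto simp: carrier_Pow_mod_Fin)
    have "finite (A v - C)" if "v \<in> V" for v
    proof -
      have "f v \<sqsubseteq>\<^bsub>Pow_mod_Fin\<^esub> mod_fin C"
        unfolding C[symmetric] using that
        by (intro least_Upper_above[OF lub]) (auto simp: f_def)
      then show ?thesis by (simp add: f_def mod_fin_le_iff)
    qed
    then have "finite (\<Union>v\<in>V. A v - C)" using V by blast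
    then have "finite (UNIV - C)"
      by (rule rev_finite_subset) (auto simp: A_def wV)
    then show ?thesis by (simp add: C top_Pow_mod_Fin mod_fin_eq_iff)
  qed
  have "pairwise (\<lambda>x y. x \<sqinter>\<^bsub>Pow_mod_Fin\<^esub> y = \<bottom>\<^bsub>Pow_mod_Fin\<^esub>) (f ` V)"
  proof (rule pairwise_imageI)
    fix u v :: 'a assume "u \<noteq> v"
    then show "f u \<sqinter>\<^bsub>Pow_mod_Fin\<^esub> f v = \<bottom>\<^bsub>Pow_mod_Fin\<^esub>"
      by (simp add: f_def meet_mod_fin bottom_Pow_mod_Fin disj)
  qed
  then have "boolean_partition Pow_mod_Fin (f ` V)"
    using V fne sup by (auto simp: boolean_partition_def f_def)
  moreover have "digraph_isomorphic V E (f ` V) (partition_arrows Pow_mod_Fin shift (f ` V))"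
    unfolding digraph_isomorphic_def
    by (rule exI[of _ f]) (auto simp: injf inj_on_imp_bij_betw partition_arrows_def arrow)
  ultimately show ?thesis by (auto simp: represented_by_partition_def)
qed

text \<open>A formula cannot quantify over types, so the condition on incompressible systems occurs
  twice: over \<open>nat set set\<close>, which is large enough for the full equivalence, and over
  an arbitrary type \<open>'b\<close>, for the implication to strong connectedness.\<close>

theorem theorem7p8:
  fixes V :: "'a set" and E :: "('a \<times> 'a) set"
  assumes "finite_digraph V E"
  shows "(strongly_connected V E \<longleftrightarrow>
            (\<exists>(L :: nat set set gorder) \<alpha>. dynamical_system L \<alpha> \<and> incompressible L \<alpha> \<and>
               represented_by_partition V E L \<alpha>)) \<and>
         (strongly_connected V E \<longleftrightarrow> represented_by_partition V E Pow_mod_Fin shift) \<and>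
         ((\<exists>(L :: 'b gorder) \<alpha>. dynamical_system L \<alpha> \<and> incompressible L \<alpha> \<and>
             represented_by_partition V E L \<alpha>) \<longrightarrow> strongly_connected V E)"
proof (intro conjI iffI impI)
  assume "strongly_connected V E"
  then show "represented_by_partition V E Pow_mod_Fin shift"
    by (rule represented_if_strongly_connected[OF assms])
  then show "\<exists>(L :: nat set set gorder) \<alpha>. dynamical_system L \<alpha> \<and> incompressible L \<alpha> \<and>
      represented_by_partition V E L \<alpha>"
    using dynamical_system_shift incompressible_shift by (intro exI conjI)
next
  assume "represented_by_partition V E Pow_mod_Fin shift"
  then show "strongly_connected V E"
    by (rule strongly_connected_if_represented[OF assms dynamical_system_shift
          incompressible_shift])
qed (elim exE conjE, rule strongly_connected_if_represented[OF assms], assumption+)+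

end
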